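(* Let $0<\mu<L$, let $K\ge2$ be an integer, and let $(\gamma,\beta)\in\Omega_{K\text{-}\circ}(\mathcal F_{\mu,L})$. There exists $\kappa_P>0$ such that, for all $\delta_0,\delta_1\in\mathbb R^2$ with $\sqrt{\|\delta_0\|^2+\|\delta_1\|^2}\le\kappa_P\, r_{\max}$, the sequence $(z_t)_{t\in\mathbb N}$ generated by $\mathrm{HB}_{\gamma,\beta}(\psi)$ initialized at $(z_0,z_1)=(x_0^\circ+\delta_0,\ x_1^\circ+\delta_1)$ has the following properties: 1. for all $t\in\mathbb N$, $z_t\in\mathcal V_{t\bmod K}$; 2. the sequence $\delta_t:=z_t-x_t^\circ$ follows the dynamic of $\mathrm{HB}_{\gamma,\beta}\big(x\mapsto\frac\mu2\|x\|^2\big)$ initialized at $(\delta_0,\delta_1)$, i.e. $\delta_{t+1}=\delta_t-\gamma\mu\,\delta_t+\beta(\delta_t-\delta_{t-1})$ for all $t\ge1$; 3. consequently, $\|z_t-x_t^\circ\|$ converges to $0$ as $t\to\infty$, at rate $\rho_{\gamma,\beta}(\mathcal Q_{\mu,\mu})$.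
   Context: For $0<\mu\le L$, $\mathcal F_{\mu,L}$ is the set of continuously differentiable functions $f:\mathbb R^d\to\mathbb R$ ($d\ge1$ arbitrary) with $f(x)\le f(y)+\langle\nabla f(y),x-y\rangle+\frac L2\|x-y\|^2$ and $f(x)\ge f(y)+\langle\nabla f(y),x-y\rangle+\frac\mu2\|x-y\|^2$ for all $x,y$. For $\gamma,\beta\in\mathbb R$ and differentiable $f$, $\mathrm{HB}_{\gamma,\beta}(f)$ is the iteration $z_{t+1}=z_t-\gamma\nabla f(z_t)+\beta(z_t-z_{t-1})$, $t\ge1$, from initial points $z_0,z_1$. For $K$ points not all equal, $\mathrm{HB}_{\gamma,\beta}(f)$ cycles on $(x_0,\dots,x_{K-1})$ if the sequence initialized at $z_0=x_0,z_1=x_1$ satisfies $z_t=x_{t\bmod K}$ for all $t\ge0$. $\Omega_{\mathrm{cv}}(\mathcal Q_{\mu,L})=\{(\gamma,\beta):\beta\in(-1,1),\ 0<\gamma<\frac2L(1+\beta)\}$. With $\theta_K=2\pi/K$, $x_t^\circ=(\cos(t\theta_K),\sin(t\theta_K))^\top\in\mathbb R^2$ for all $t\in\mathbb Z$ (a $K$-periodic sequence), and $R$ is the rotation of $\mathbb R^2$ by angle $\theta_K$. $\Omega_{K\text{-}\circ}(\mathcal F_{\mu,L})$ is the set of $(\gamma,\beta)\in\Omega_{\mathrm{cv}}(\mathcal Q_{\mu,L})$ for which there is $f\in\mathcal F_{\mu,L}$ on $\mathbb R^2$ such that $\mathrm{HB}_{\gamma,\beta}(f)$ cycles on $(x_0^\circ,\dots,x_{K-1}^\circ)$.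 $M=\frac{(1+\beta-\mu\gamma)I_2-R-\beta R^{-1}}{(L-\mu)\gamma}$ and $\psi(x)=\frac L2\|x\|^2-\frac{L-\mu}2 d\big(x,\mathrm{conv}\{Mx_t^\circ: 0\le t\le K-1\}\big)^2$ for $x\in\mathbb R^2$, where $d$ is Euclidean distance to a set. $\mathcal V_k$ ($0\le k\le K-1$) is the largest neighborhood of $x_k^\circ$ on which $\psi$ is quadratic with Hessian $\mu I_2$; formally, $\mathcal V_k$ is the set of all points having the same Euclidean projection onto $\mathrm{conv}\{Mx_t^\circ:0\le t\le K-1\}$ as $x_k^\circ$. $r_{\max}=-\Big\langle (I_2-M)x_0^\circ,\ \frac{M(x_1^\circ-x_0^\circ)}{\|M(x_1^\circ-x_0^\circ)\|}\Big\rangle$. $\rho_{\gamma,\beta}(\mathcal Q_{\mu,\mu})$ is the worst-case asymptotic rate of $\mathrm{HB}_{\gamma,\beta}$ on quadratics with Hessian $\mu I$, i.e. the spectral radius of $\begin{pmatrix}1+\beta-\gamma\mu&-\beta\\1&0\end{pmatrix}$; "converges at rate $\rho$" means: for every $\varepsilon>0$ there is $T_0$ such that $\|\delta_t\|\le(\rho+\varepsilon)^t(\|\delta_0\|^2+\|\delta_1\|^2)^{1/2}$ for all $t\ge T_0$. *)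

theory Defs
  imports
    "Jordan_Normal_Form.Spectral_Radius"
    "HOL-Analysis.Analysis"
begin

text \<open>
  Both imported developments provide a constant \<open>mat\<close>. Matrices acting on \<open>real ^ 2\<close> are those of
  HOL-Analysis; the matrix type of Jordan_Normal_Form is used only for the spectral radius.
\<close>

section \<open>Smooth strongly convex functions\<close>

text \<open>Unspecified at points where \<open>f\<close> is not differentiable.\<close>

definition grad :: "('a::euclidean_space \<Rightarrow> real) \<Rightarrow> 'a \<Rightarrow> 'a" where
  "grad f x = (THE g. GDERIV f x :> g)"

definition F_class :: "real \<Rightarrow> real \<Rightarrow> ('a::euclidean_space \<Rightarrow> real) set" where
  "F_class \<mu> L = {f.
     (\<forall>x. f differentiable (at x)) \<and> continuous_on UNIV (grad f) \<and>
     (\<forall>x y. f x \<le> f y + inner (grad f y) (x - y) + L / 2 * (norm (x - y))\<^sup>2) \<and>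
     (\<forall>x y. f x \<ge> f y + inner (grad f y) (x - y) + \<mu> / 2 * (norm (x - y))\<^sup>2)}"

section \<open>The heavy-ball method\<close>

fun HB :: "real \<Rightarrow> real \<Rightarrow> ('a::euclidean_space \<Rightarrow> real) \<Rightarrow> 'a \<Rightarrow> 'a \<Rightarrow> nat \<Rightarrow> 'a" where
  "HB \<gamma> \<beta> f z0 z1 0 = z0"
| "HB \<gamma> \<beta> f z0 z1 (Suc 0) = z1"
| "HB \<gamma> \<beta> f z0 z1 (Suc (Suc t)) =
     HB \<gamma> \<beta> f z0 z1 (Suc t) - \<gamma> *\<^sub>R grad f (HB \<gamma> \<beta> f z0 z1 (Suc t))
       + \<beta> *\<^sub>R (HB \<gamma> \<beta> f z0 z1 (Suc t) - HB \<gamma> \<beta> f z0 z1 t)"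

text \<open>Only the values \<open>x 0, \<dots>, x (K - 1)\<close> of the family \<open>x\<close> matter.\<close>

definition HB_cycles ::
    "real \<Rightarrow> real \<Rightarrow> ('a::euclidean_space \<Rightarrow> real) \<Rightarrow> nat \<Rightarrow> (nat \<Rightarrow> 'a) \<Rightarrow> bool" where
  "HB_cycles \<gamma> \<beta> f K x \<longleftrightarrow>
     (\<exists>i<K. \<exists>j<K. x i \<noteq> x j) \<and> (\<forall>t. HB \<gamma> \<beta> f (x 0) (x 1) t = x (t mod K))"

text \<open>Asymptotic rate on quadratics with Hessian \<open>\<mu> I\<close>.\<close>

definition rho_quad :: "real \<Rightarrow> real \<Rightarrow> real \<Rightarrow> real" where
  "rho_quad \<gamma> \<beta> \<mu> =
     spectral_radius (map_mat complex_of_real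
       (mat_of_rows_list 2 [[1 + \<beta> - \<gamma> * \<mu>, - \<beta>], [1, 0]]))"

definition converges_at_rate :: "(nat \<Rightarrow> 'a::real_normed_vector) \<Rightarrow> real \<Rightarrow> bool" where
  "converges_at_rate \<delta> \<rho> \<longleftrightarrow>
     (\<forall>\<epsilon>>0. \<exists>T0. \<forall>t\<ge>T0.
        norm (\<delta> t) \<le> (\<rho> + \<epsilon>) ^ t * sqrt ((norm (\<delta> 0))\<^sup>2 + (norm (\<delta> 1))\<^sup>2))"

section \<open>Cycles on the roots of unity\<close>

text \<open>The set \<open>\<Omega>\<^sub>c\<^sub>v(\<Q>\<^sub>\<mu>\<^sub>,\<^sub>L)\<close>; its description does not involve \<open>\<mu>\<close>.\<close>

definition Omega_cv_Q :: "real \<Rightarrow> real \<Rightarrow> (real \<times> real) set" where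
  "Omega_cv_Q \<mu> L = {(\<gamma>, \<beta>). - 1 < \<beta> \<and> \<beta> < 1 \<and> 0 < \<gamma> \<and> \<gamma> < 2 / L * (1 + \<beta>)}"

definition theta :: "nat \<Rightarrow> real" where
  "theta K = 2 * pi / real K"

definition xcirc :: "nat \<Rightarrow> int \<Rightarrow> real ^ 2" where
  "xcirc K t = vector [cos (of_int t * theta K), sin (of_int t * theta K)]"

definition Omega_circ :: "nat \<Rightarrow> real \<Rightarrow> real \<Rightarrow> (real \<times> real) set" where
  "Omega_circ K \<mu> L = {(\<gamma>, \<beta>). (\<gamma>, \<beta>) \<in> Omega_cv_Q \<mu> L \<and>
     (\<exists>f :: real ^ 2 \<Rightarrow> real. f \<in> F_class \<mu> L \<and> HB_cycles \<gamma> \<beta> f K (\<lambda>k. xcirc K (int k)))}"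

definition Rot :: "nat \<Rightarrow> real ^ 2 ^ 2" where
  "Rot K = vector [vector [cos (theta K), - sin (theta K)],
                   vector [sin (theta K),   cos (theta K)]]"

definition M_mat :: "nat \<Rightarrow> real \<Rightarrow> real \<Rightarrow> real \<Rightarrow> real \<Rightarrow> real ^ 2 ^ 2" where
  "M_mat K \<mu> L \<gamma> \<beta> =
     (1 / ((L - \<mu>) * \<gamma>)) *\<^sub>R
       ((1 + \<beta> - \<mu> * \<gamma>) *\<^sub>R Finite_Cartesian_Product.mat 1 - Rot K - \<beta> *\<^sub>R matrix_inv (Rot K))"

definition M_hull :: "nat \<Rightarrow> real \<Rightarrow> real \<Rightarrow> real \<Rightarrow> real \<Rightarrow> (real ^ 2) set" where
  "M_hull K \<mu> L \<gamma> \<beta> = convex hull ((\<lambda>k. M_mat K \<mu> L \<gamma> \<beta> *v xcirc K (int k)) ` {..<K})"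

definition psi :: "nat \<Rightarrow> real \<Rightarrow> real \<Rightarrow> real \<Rightarrow> real \<Rightarrow> real ^ 2 \<Rightarrow> real" where
  "psi K \<mu> L \<gamma> \<beta> x =
     L / 2 * (norm x)\<^sup>2 - (L - \<mu>) / 2 * (infdist x (M_hull K \<mu> L \<gamma> \<beta>))\<^sup>2"

text \<open>
  For \<open>K \<ge> 1\<close> the hull is nonempty, compact and convex, so \<open>closest_point\<close> is the Euclidean
  projection onto it.
\<close>

definition V_nbhd :: "nat \<Rightarrow> real \<Rightarrow> real \<Rightarrow> real \<Rightarrow> real \<Rightarrow> nat \<Rightarrow> (real ^ 2) set" where
  "V_nbhd K \<mu> L \<gamma> \<beta> k =
     {x. closest_point (M_hull K \<mu> L \<gamma> \<beta>) x =
         closest_point (M_hull K \<mu> L \<gamma> \<beta>) (xcirc K (int k))}"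

definition r_max :: "nat \<Rightarrow> real \<Rightarrow> real \<Rightarrow> real \<Rightarrow> real \<Rightarrow> real" where
  "r_max K \<mu> L \<gamma> \<beta> =
     (let M = M_mat K \<mu> L \<gamma> \<beta>; v = M *v (xcirc K 1 - xcirc K 0)
      in - inner ((Finite_Cartesian_Product.mat 1 - M) *v xcirc K 0) ((1 / norm v) *\<^sub>R v))"

end

theory Submission
  imports Defs
begin

text \<open>
  Identify \<open>real ^ 2\<close> with the complex plane, so that \<open>M\<close> is multiplication by a number \<open>p + i b\<close> with
  \<open>b \<le> 0\<close>. The point \<open>M x\<^sub>k\<close> is the projection of \<open>x\<^sub>k + \<delta>\<close> onto the hull as soon as \<open>x\<^sub>k + \<delta> - M x\<^sub>k\<close>
  makes a nonpositive inner product with every chord \<open>M x\<^sub>k\<^sub>+\<^sub>i - M x\<^sub>k\<close>. Because \<open>b \<le> 0\<close>, the chord to the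
  successor \<open>i = 1\<close> is the critical one, and it gives exactly the condition \<open>norm \<delta> \<le> r_max\<close>.
  On these balls the gradient of \<open>psi\<close> at \<open>x\<^sub>k + \<delta>\<close> is \<open>\<mu> (x\<^sub>k + \<delta>) + (L - \<mu>) M x\<^sub>k\<close>, and \<open>M\<close> is chosen such
  that the cycle is then reproduced with the error following the heavy-ball method on a quadratic. That linear
  recurrence is stable, so the error stays in the ball, up to a constant factor that determines \<open>\<kappa>\<close>.
\<close>

section \<open>Second-order linear recurrences\<close>

text \<open>Factoring the recurrence makes \<open>a (Suc t) - l1 * a t\<close> geometric with ratio
  \<open>l2\<close>; a second induction then solves the remaining first-order recurrence. A repeated
  root is covered too, because the gap between \<open>\<rho>\<close> and \<open>r\<close> absorbs
  the linear factor in \<open>t\<close>.\<close>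

lemma second_order_recurrence_bound:
  fixes a :: "nat \<Rightarrow> 'a::real_normed_field"
  assumes rec: "\<And>t. a (Suc (Suc t)) = (l1 + l2) * a (Suc t) - l1 * l2 * a t"
    and l1: "norm l1 \<le> \<rho>" and l2: "norm l2 \<le> \<rho>" and r: "\<rho> < r"
  shows "norm (a t) \<le> (norm (a 0) + (norm (a 1) + \<rho> * norm (a 0)) / (r - \<rho>)) * r ^ t"
proof -
  have \<rho>0: "0 \<le> \<rho>" using l1 norm_ge_zero[of l1] by linarith
  define U where "U = norm (a 1) + \<rho> * norm (a 0)"
  have U0: "0 \<le> U" using \<rho>0 by (simp add: U_def)
  \<comment> \<open>Chosen so that \<open>U \<le> (r - \<rho>) * C\<close>, which is what turns
    \<open>\<rho> * C * r ^ t + \<rho> ^ t * U\<close> into at most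
    \<open>C * r ^ Suc t\<close>.\<close>
  define C where "C = norm (a 0) + U / (r - \<rho>)"
  have C0: "0 \<le> C" using U0 r by (simp add: C_def)
  have "(r - \<rho>) * C = (r - \<rho>) * norm (a 0) + U"
    using r by (simp add: C_def distrib_left)
  hence UC: "U \<le> (r - \<rho>) * C" using r by simp
  have step: "norm (a (Suc t) - l1 * a t) \<le> \<rho> ^ t * U" for t
  proof (induction t)
    case 0
    have "norm (a (Suc 0) - l1 * a 0) \<le> norm (a (Suc 0)) + norm l1 * norm (a 0)"
      by (metis norm_mult norm_triangle_ineq4)
    also have "\<dots> \<le> U" using l1 by (simp add: U_def mult_right_mono)
    finally show ?case by simp
  next
    case (Suc t)
    have "a (Suc (Suc t)) - l1 * a (Suc t) = l2 * (a (Suc t) - l1 * a t)"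
      by (simp add: rec algebra_simps)
    hence "norm (a (Suc (Suc t)) - l1 * a (Suc t)) = norm l2 * norm (a (Suc t) - l1 * a t)"
      by (simp add: norm_mult)
    also have "\<dots> \<le> \<rho> * (\<rho> ^ t * U)"
      using Suc l2 \<rho>0 by (intro mult_mono) auto
    finally show ?case by (simp add: mult.assoc)
  qed
  have "norm (a t) \<le> C * r ^ t"
  proof (induction t)
    case 0
    show ?case using U0 r by (simp add: C_def)
  next
    case (Suc t)
    have "norm (a (Suc t)) \<le> norm l1 * norm (a t) + norm (a (Suc t) - l1 * a t)"
      using norm_triangle_ineq[of "l1 * a t" "a (Suc t) - l1 * a t"] by (simp add: norm_mult)
    also have "\<dots> \<le> \<rho> * (C * r ^ t) + \<rho> ^ t * U"
      using Suc l1 \<rho>0 step[of t] by (intro add_mono mult_mono) auto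
    also have "\<rho> ^ t * U \<le> r ^ t * ((r - \<rho>) * C)"
      using UC U0 \<rho>0 r by (intro mult_mono power_mono) auto
    finally show ?case by (simp add: algebra_simps)
  qed
  thus ?thesis by (simp add: C_def U_def)
qed

lemma complex_quadratic_factors:
  fixes p q :: complex
  obtains l1 l2 where "l1 + l2 = p" "l1 * l2 = q"
proof
  show "(p + csqrt (p\<^sup>2 - 4 * q)) / 2 + (p - csqrt (p\<^sup>2 - 4 * q)) / 2 = p"
    by (simp add: field_simps)
  have "(p + csqrt (p\<^sup>2 - 4 * q)) * (p - csqrt (p\<^sup>2 - 4 * q)) = 4 * q"
    by (simp add: algebra_simps flip: power2_eq_square)
  thus "(p + csqrt (p\<^sup>2 - 4 * q)) / 2 * ((p - csqrt (p\<^sup>2 - 4 * q)) / 2) = q"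
    by simp
qed

text \<open>Each coordinate, read as a complex number, satisfies the scalar recurrence with the two
  complex roots. Summing the coordinate bounds accounts for the factor
  \<open>CARD('n)\<close>.\<close>

lemma vector_recurrence_bound:
  fixes d :: "nat \<Rightarrow> real ^ 'n"
  assumes rec: "\<And>t. d (Suc (Suc t)) = p *\<^sub>R d (Suc t) - q *\<^sub>R d t"
    and roots: "\<And>l::complex. l\<^sup>2 - complex_of_real p * l + complex_of_real q = 0 \<Longrightarrow> norm l \<le> \<rho>"
    and r: "\<rho> < r"
  shows "norm (d t) \<le> (real CARD('n) * (1 + (1 + \<rho>) / (r - \<rho>))) * r ^ t
            * sqrt ((norm (d 0))\<^sup>2 + (norm (d 1))\<^sup>2)"
proof -
  obtain l1 l2 :: complex where l: "l1 + l2 = complex_of_real p" "l1 * l2 = complex_of_real q"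
    by (rule complex_quadratic_factors)
  have l1: "norm l1 \<le> \<rho>" and l2: "norm l2 \<le> \<rho>"
    by (rule roots, simp add: l(1)[symmetric] l(2)[symmetric] algebra_simps power2_eq_square)+
  have \<rho>0: "0 \<le> \<rho>" using l1 norm_ge_zero[of l1] by linarith
  define D where "D = sqrt ((norm (d 0))\<^sup>2 + (norm (d 1))\<^sup>2)"
  have D: "norm (d 0) \<le> D" "norm (d 1) \<le> D"
    unfolding D_def by (rule real_le_rsqrt, simp)+
  have r0: "0 < r" using \<rho>0 r by linarith
  have comp: "\<bar>vec_nth (d t) i\<bar> \<le> (1 + (1 + \<rho>) / (r - \<rho>)) * D * r ^ t" for i
  proof -
    define a where "a = (\<lambda>t. complex_of_real (vec_nth (d t) i))"
    have a: "norm (a 0) \<le> D" "norm (a 1) \<le> D"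
      unfolding a_def norm_of_real
      using D component_le_norm_cart[of "d 0" i] component_le_norm_cart[of "d 1" i] by linarith+
    have "a (Suc (Suc t)) = (l1 + l2) * a (Suc t) - l1 * l2 * a t" for t
      by (simp add: a_def rec l)
    hence "norm (a t) \<le> (norm (a 0) + (norm (a 1) + \<rho> * norm (a 0)) / (r - \<rho>)) * r ^ t"
      by (rule second_order_recurrence_bound[OF _ l1 l2 r])
    also have "\<dots> \<le> (D + (D + \<rho> * D) / (r - \<rho>)) * r ^ t"
      using a \<rho>0 r r0 by (intro mult_right_mono add_mono divide_right_mono mult_left_mono) auto
    also have "\<dots> = (1 + (1 + \<rho>) / (r - \<rho>)) * D * r ^ t"
      by (simp add: algebra_simps add_divide_distrib)
    finally show ?thesis by (simp add: a_def)
  qed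
  have "norm (d t) \<le> (\<Sum>i\<in>UNIV. \<bar>vec_nth (d t) i\<bar>)"
    by (rule norm_le_l1_cart)
  also have "\<dots> \<le> (\<Sum>i\<in>(UNIV::'n set). (1 + (1 + \<rho>) / (r - \<rho>)) * D * r ^ t)"
    by (intro sum_mono comp)
  finally show ?thesis by (simp add: D_def mult_ac)
qed

text \<open>A nonreal root has squared modulus \<open>q\<close>. For a real root \<open>x\<close>
  with \<open>\<bar>x\<bar> \<ge> 1\<close>, the equation would give
  \<open>x\<^sup>2 + q = p * x < (1 + q) * \<bar>x\<bar>\<close>, against
  \<open>(\<bar>x\<bar> - 1) * (\<bar>x\<bar> - q) \<ge> 0\<close>.\<close>

lemma stable_quadratic_roots:
  fixes z :: complex and p q :: real
  assumes z: "z\<^sup>2 - complex_of_real p * z + complex_of_real q = 0"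
    and q: "\<bar>q\<bar> < 1" and p: "\<bar>p\<bar> < 1 + q"
  shows "norm z < 1"
proof -
  have re: "(Re z)\<^sup>2 - (Im z)\<^sup>2 - p * Re z + q = 0" and im: "Im z * (2 * Re z - p) = 0"
    using z by (simp_all add: complex_eq_iff power2_eq_square algebra_simps)
  show ?thesis
  proof (cases "Im z = 0")
    case True
    show ?thesis
    proof (rule ccontr)
      assume "\<not> norm z < 1"
      hence x: "\<bar>Re z\<bar> \<ge> 1" using True by (simp add: cmod_def)
      have "p * Re z \<le> \<bar>p\<bar> * \<bar>Re z\<bar>" by (metis abs_ge_self abs_mult)
      also have "\<dots> < (1 + q) * \<bar>Re z\<bar>" using p x by (intro mult_strict_right_mono) auto
      finally have "p * Re z < (1 + q) * \<bar>Re z\<bar>" .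
      moreover have "0 \<le> (\<bar>Re z\<bar> - 1) * (\<bar>Re z\<bar> - q)" using x q by (intro mult_nonneg_nonneg) auto
      moreover have "\<bar>Re z\<bar> * \<bar>Re z\<bar> = (Re z)\<^sup>2" by (simp add: power2_eq_square)
      ultimately show False using re True by (simp add: algebra_simps)
    qed
  next
    case False
    hence "p = 2 * Re z" using im by simp
    hence "(Re z)\<^sup>2 + (Im z)\<^sup>2 = q" using re by (simp add: power2_eq_square)
    thus ?thesis using q by (simp add: cmod_def)
  qed
qed

section \<open>The spectral radius of the heavy-ball matrix\<close>

text \<open>The second row forces an eigenvector to be a multiple of \<open>(l, 1)\<close>; the
  first row then becomes the characteristic equation.\<close>

lemma eigenvalue_companion:
  fixes p q l :: "'a::field"
  shows "eigenvalue (mat_of_rows_list 2 [[p, - q], [1, 0]]) l \<longleftrightarrow> l\<^sup>2 - p * l + q = 0"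
    (is "eigenvalue ?A l \<longleftrightarrow> _")
proof
  have [simp]: "dim_row ?A = 2" by (simp add: mat_of_rows_list_def)
  assume "eigenvalue ?A l"
  then obtain v where v: "v \<in> carrier_vec 2" "v \<noteq> 0\<^sub>v 2" and eq: "?A *\<^sub>v v = l \<cdot>\<^sub>v v"
    unfolding eigenvalue_def eigenvector_def by auto
  have dim: "dim_vec v = 2" using v by simp
  have e0: "p * vec_index v 0 - q * vec_index v 1 = l * vec_index v 0"
    using arg_cong[OF eq, of "\<lambda>w. vec_index w 0"] dim
    by (simp add: mat_of_rows_list_def scalar_prod_def numeral_2_eq_2)
  have e1: "vec_index v 0 = l * vec_index v 1"
    using arg_cong[OF eq, of "\<lambda>w. vec_index w 1"] dim
    by (simp add: mat_of_rows_list_def scalar_prod_def numeral_2_eq_2)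
  have "vec_index v 1 \<noteq> 0"
  proof
    assume "vec_index v 1 = 0"
    hence "v = 0\<^sub>v 2" using dim e1 by (intro eq_vecI) (auto simp: less_2_cases_iff)
    thus False using v by simp
  qed
  moreover have "(l\<^sup>2 - p * l + q) * vec_index v 1 = 0"
    using e0 e1 by (simp add: algebra_simps power2_eq_square)
  ultimately show "l\<^sup>2 - p * l + q = 0" by simp
next
  assume root: "l\<^sup>2 - p * l + q = 0"
  let ?v = "vec_of_list [l, 1]"
  have "?A *\<^sub>v ?v = l \<cdot>\<^sub>v ?v"
    using root
    by (intro eq_vecI)
      (auto simp: less_Suc_eq mat_of_rows_list_def scalar_prod_def numeral_2_eq_2
        vec_of_list_index algebra_simps)
  moreover have "?v \<noteq> 0\<^sub>v 2"
  proof
    assume "?v = 0\<^sub>v 2"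
    hence "vec_index ?v 1 = vec_index (0\<^sub>v 2) 1" by simp
    thus False by (simp add: vec_of_list_index)
  qed
  ultimately show "eigenvalue ?A l"
    unfolding eigenvalue_def eigenvector_def
    by (intro exI[of _ ?v]) (auto simp: mat_of_rows_list_def intro!: carrier_vecI)
qed

lemma heavy_ball_matrix:
  "map_mat complex_of_real (mat_of_rows_list 2 [[p, - q], [1, 0]])
     = mat_of_rows_list 2 [[complex_of_real p, - complex_of_real q], [1, 0]]"
  by (intro eq_matI) (auto simp: mat_of_rows_list_def less_Suc_eq numeral_2_eq_2)

lemma root_le_rho_quad:
  assumes "l\<^sup>2 - complex_of_real (1 + \<beta> - \<gamma> * \<mu>) * l + complex_of_real \<beta> = 0"
  shows "norm l \<le> rho_quad \<gamma> \<beta> \<mu>"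
  unfolding rho_quad_def heavy_ball_matrix
proof (rule spectral_radius_mem_max(2)[where n = 2])
  show "norm l \<in> norm ` spectrum
      (mat_of_rows_list 2 [[complex_of_real (1 + \<beta> - \<gamma> * \<mu>), - complex_of_real \<beta>], [1, 0]])"
    using assms by (intro imageI) (simp add: spectrum_def eigenvalue_companion)
qed (auto simp: mat_of_rows_list_def)

text \<open>The spectral radius is attained at an eigenvalue, so the strict bound on every single
  root carries over to it.\<close>

lemma rho_quad_less_1:
  assumes "\<bar>\<beta>\<bar> < 1" and "\<bar>1 + \<beta> - \<gamma> * \<mu>\<bar> < 1 + \<beta>"
  shows "rho_quad \<gamma> \<beta> \<mu> < 1"
proof -
  let ?A = "mat_of_rows_list 2 [[complex_of_real (1 + \<beta> - \<gamma> * \<mu>), - complex_of_real \<beta>], [1, 0]]"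
  have "rho_quad \<gamma> \<beta> \<mu> \<in> norm ` spectrum ?A"
    unfolding rho_quad_def heavy_ball_matrix
    by (rule spectral_radius_mem_max(1)[where n = 2]) (auto simp: mat_of_rows_list_def)
  then obtain l where "rho_quad \<gamma> \<beta> \<mu> = norm l" "eigenvalue ?A l"
    by (auto simp: spectrum_def)
  thus ?thesis
    using stable_quadratic_roots[OF _ assms] by (simp add: eigenvalue_companion)
qed

section \<open>Gradients\<close>

text \<open>As \<open>grad\<close> is a definite description, uniqueness is needed: two candidates
  induce the same linear map, and testing it on \<open>g' - g\<close> shows that this difference has
  norm zero.\<close>

lemma grad_eqI:
  assumes "GDERIV f x :> g"
  shows "grad f x = g"
  unfolding grad_def
proof (rule the_equality)
  show "GDERIV f x :> g" by (rule assms)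
next
  fix g' assume "GDERIV f x :> g'"
  hence "(\<lambda>h. inner h g') = (\<lambda>h. inner h g)"
    using assms has_derivative_unique unfolding gderiv_def by blast
  hence "inner (g' - g) g' = inner (g' - g) g" by metis
  hence "inner (g' - g) (g' - g) = 0" by (simp add: inner_diff_right)
  thus "g' = g" by simp
qed

lemma GDERIV_norm_squared: "GDERIV (\<lambda>x. c / 2 * (norm x)\<^sup>2) x :> c *\<^sub>R x"
  unfolding gderiv_def power2_norm_eq_inner
  by (auto intro!: derivative_eq_intros simp: inner_commute)

text \<open>The linearization error is squeezed by swapping projections: \<open>?P x\<close>
  competes with \<open>?P y\<close> in the distance from \<open>y\<close>, and conversely from
  \<open>x\<close>. Both comparisons leave an error of at most
  \<open>norm h * norm h\<close>.\<close>

lemma GDERIV_infdist_squared: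
  fixes S :: "'a::euclidean_space set"
  assumes S: "closed S" "convex S" "S \<noteq> {}"
  shows "GDERIV (\<lambda>x. (infdist x S)\<^sup>2) x :> 2 *\<^sub>R (x - closest_point S x)"
  unfolding gderiv_def
proof (rule has_derivativeI_sandwich[of 1 _ _ _ _ "\<lambda>y. norm (y - x)"])
  let ?P = "closest_point S"
  have d: "(infdist y S)\<^sup>2 = inner (y - ?P y) (y - ?P y)" for y
    using S(1,3)
    by (simp add: infdist_eq_setdist setdist_closest_point dist_norm power2_norm_eq_inner)
  have le: "inner (y - ?P y) (y - ?P y) \<le> inner (y - ?P w) (y - ?P w)" for y w
  proof -
    have "norm (y - ?P y) \<le> norm (y - ?P w)"
      using closest_point_le[OF S(1) closest_point_in_set[OF S(1,3)], of y w] by (simp add: dist_norm)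
    hence "(norm (y - ?P y))\<^sup>2 \<le> (norm (y - ?P w))\<^sup>2" by (simp add: power_mono)
    thus ?thesis by (simp add: power2_norm_eq_inner)
  qed
  show "bounded_linear (\<lambda>h. inner h (2 *\<^sub>R (x - ?P x)))"
    by (rule bounded_linear_inner_left)
  show "((\<lambda>y. norm (y - x)) \<longlongrightarrow> 0) (at x)"
    by (rule tendsto_eq_intros refl | simp)+
  fix y assume "y \<noteq> x"
  define h where "h = y - x"
  have y: "y = x + h" by (simp add: h_def)
  have up: "inner (y - ?P y) (y - ?P y) \<le> inner (x - ?P x) (x - ?P x) + 2 * inner h (x - ?P x) + inner h h"
    using le[of y x] by (simp add: y algebra_simps inner_simps inner_commute)
  have "inner (x - ?P x) (x - ?P x) \<le> inner (y - ?P y - h) (y - ?P y - h)"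
    using le[of x y] by (simp add: h_def)
  also have "\<dots> = inner (y - ?P y) (y - ?P y) - 2 * inner h (x - ?P x) - 2 * inner h (?P x - ?P y) - inner h h"
    by (simp add: y algebra_simps inner_simps inner_commute)
  finally have lo: "inner (x - ?P x) (x - ?P x) \<le> \<dots>" .
  \<comment> \<open>The lower estimate still contains \<open>?P x - ?P y\<close>; nonexpansiveness
    of the projection makes that term quadratic in \<open>h\<close>.\<close>
  have "norm (?P x - ?P y) \<le> norm h"
    using closest_point_lipschitz[OF S(2,1,3), of x y] by (simp add: h_def dist_norm norm_minus_commute)
  hence "\<bar>inner h (?P x - ?P y)\<bar> \<le> norm h * norm h"
    using Cauchy_Schwarz_ineq2[of h "?P x - ?P y"] mult_left_mono[of _ "norm h" "norm h"]
    by (meson norm_ge_zero order_trans)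
  moreover have hh: "inner h h = norm h * norm h"
    by (simp add: power2_norm_eq_inner flip: power2_eq_square)
  ultimately have "\<bar>(infdist y S)\<^sup>2 - (infdist x S)\<^sup>2 - inner h (2 *\<^sub>R (x - ?P x))\<bar> \<le> norm h * norm h"
    unfolding d abs_le_iff using up lo by (simp; linarith)
  thus "norm ((infdist y S)\<^sup>2 - (infdist x S)\<^sup>2 - inner (y - x) (2 *\<^sub>R (x - ?P x)))
      / norm (y - x) \<le> norm (y - x)"
    using \<open>y \<noteq> x\<close> by (simp add: h_def divide_le_eq)
qed auto

lemma grad_psi:
  assumes "2 \<le> K"
  shows "grad (psi K \<mu> L \<gamma> \<beta>) x
    = \<mu> *\<^sub>R x + (L - \<mu>) *\<^sub>R closest_point (M_hull K \<mu> L \<gamma> \<beta>) x"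
proof (rule grad_eqI)
  let ?S = "M_hull K \<mu> L \<gamma> \<beta>"
  have "compact ?S" unfolding M_hull_def by (intro compact_convex_hull finite_imp_compact) auto
  moreover have "convex ?S" by (simp add: M_hull_def)
  moreover have "?S \<noteq> {}" using assms by (auto simp: M_hull_def lessThan_empty_iff)
  ultimately have "GDERIV (\<lambda>x. (infdist x ?S)\<^sup>2) x :> 2 *\<^sub>R (x - closest_point ?S x)"
    by (intro GDERIV_infdist_squared compact_imp_closed)
  hence "GDERIV (\<lambda>x. (L - \<mu>) / 2 * (infdist x ?S)\<^sup>2) x :> (L - \<mu>) *\<^sub>R (x - closest_point ?S x)"
    unfolding gderiv_def
    by (drule_tac has_derivative_mult_right[of _ _ _ "(L - \<mu>) / 2"]) simp
  from GDERIV_diff[OF GDERIV_norm_squared this]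
  show "GDERIV (psi K \<mu> L \<gamma> \<beta>) x :> \<mu> *\<^sub>R x + (L - \<mu>) *\<^sub>R closest_point ?S x"
    unfolding psi_def[abs_def] by (rule GDERIV_subst) (simp add: algebra_simps)
qed

section \<open>The cycle and its image under \<open>M\<close>\<close>

lemma vec2_eq_iff: "x = y \<longleftrightarrow> vec_nth x 1 = vec_nth y 1 \<and> vec_nth x 2 = vec_nth y 2"
  for x y :: "'a ^ 2"
  by (simp add: vec_eq_iff forall_2)

lemma xcirc_nth [simp]:
  "vec_nth (xcirc K t) 1 = cos (of_int t * theta K)"
  "vec_nth (xcirc K t) 2 = sin (of_int t * theta K)"
  by (simp_all add: xcirc_def)

text \<open>Links the integer indices used in the chord computations with the indices below
  \<open>K\<close> that generate the hull.\<close>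

lemma xcirc_mod:
  assumes "0 < K"
  shows "xcirc K (t mod int K) = xcirc K t"
proof -
  define n where "n = t div int K"
  have t: "t = t mod int K + n * int K" by (simp add: n_def)
  have eq: "of_int t * theta K = of_int (t mod int K) * theta K + of_int n * (2 * pi)"
    using assms by (subst t) (simp add: theta_def field_simps)
  have "cos (of_int n * (2 * pi)) = 1" "sin (of_int n * (2 * pi)) = 0"
    using cos_int_2pin[of n] sin_int_2pin[of n] by (simp_all add: mult.commute)
  thus ?thesis
    unfolding vec2_eq_iff xcirc_nth eq by (simp add: sin_add cos_add)
qed

lemma Rot_mult_xcirc: "Rot K *v xcirc K t = xcirc K (t + 1)"
  by (simp add: vec2_eq_iff matrix_vector_mult_def sum_2 Rot_def distrib_right cos_add sin_add)

lemma matrix_inv_Rot_mult_xcirc: "matrix_inv (Rot K) *v xcirc K t = xcirc K (t - 1)"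
proof -
  \<comment> \<open>\<open>matrix_inv\<close> is defined by choice, so an explicit two-sided inverse
    is exhibited to make the chosen matrix an inverse.\<close>
  let ?R' = "vector [vector [cos (theta K), sin (theta K)],
                     vector [- sin (theta K), cos (theta K)]] :: real ^ 2 ^ 2"
  have "Rot K ** ?R' = Finite_Cartesian_Product.mat 1 \<and> ?R' ** Rot K = Finite_Cartesian_Product.mat 1"
    by (simp add: vec2_eq_iff matrix_matrix_mult_def sum_2 Rot_def Finite_Cartesian_Product.mat_def
        flip: power2_eq_square)
  hence "matrix_inv (Rot K) ** Rot K = Finite_Cartesian_Product.mat 1"
    unfolding matrix_inv_def by (rule someI2) simp
  hence "matrix_inv (Rot K) *v (Rot K *v xcirc K (t - 1)) = xcirc K (t - 1)"
    by (simp add: matrix_vector_mul_assoc)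
  thus ?thesis by (simp add: Rot_mult_xcirc)
qed

text \<open>This is the heavy-ball equation of the exact cycle, solved for
  \<open>M *v xcirc K t\<close> under the gradient \<open>\<mu> *\<^sub>R xcirc K t + (L - \<mu>)
  *\<^sub>R (M *v xcirc K t)\<close>.\<close>

lemma M_mat_mult_xcirc:
  "M_mat K \<mu> L \<gamma> \<beta> *v xcirc K t = (1 / ((L - \<mu>) * \<gamma>)) *\<^sub>R
     ((1 + \<beta> - \<mu> * \<gamma>) *\<^sub>R xcirc K t - xcirc K (t + 1) - \<beta> *\<^sub>R xcirc K (t - 1))"
  unfolding M_mat_def
  by (simp add: scaleR_matrix_vector_assoc[symmetric] matrix_vector_mult_diff_rdistrib
      Rot_mult_xcirc matrix_inv_Rot_mult_xcirc)

text \<open>\<open>M_re\<close> and \<open>M_im\<close> are the real and imaginary parts of the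
  complex multiplier representing \<open>M\<close>, obtained by reading \<open>Rot K\<close> as the
  unit number of angle \<open>theta K\<close>.\<close>

definition M_re :: "nat \<Rightarrow> real \<Rightarrow> real \<Rightarrow> real \<Rightarrow> real \<Rightarrow> real" where
  "M_re K \<mu> L \<gamma> \<beta> = (1 + \<beta> - \<mu> * \<gamma> - (1 + \<beta>) * cos (theta K)) / ((L - \<mu>) * \<gamma>)"

definition M_im :: "nat \<Rightarrow> real \<Rightarrow> real \<Rightarrow> real \<Rightarrow> real \<Rightarrow> real" where
  "M_im K \<mu> L \<gamma> \<beta> = - ((1 - \<beta>) * sin (theta K)) / ((L - \<mu>) * \<gamma>)"

lemma M_mat_mult_xcirc_nth:
  "vec_nth (M_mat K \<mu> L \<gamma> \<beta> *v xcirc K t) 1 =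
     M_re K \<mu> L \<gamma> \<beta> * cos (of_int t * theta K) - M_im K \<mu> L \<gamma> \<beta> * sin (of_int t * theta K)"
  "vec_nth (M_mat K \<mu> L \<gamma> \<beta> *v xcirc K t) 2 =
     M_re K \<mu> L \<gamma> \<beta> * sin (of_int t * theta K) + M_im K \<mu> L \<gamma> \<beta> * cos (of_int t * theta K)"
  unfolding M_mat_mult_xcirc M_re_def M_im_def
  by (simp_all add: distrib_right left_diff_distrib cos_add sin_add cos_diff sin_diff
      flip: add_divide_distrib diff_divide_distrib) (simp_all add: algebra_simps diff_divide_distrib add_divide_distrib)

text \<open>With \<open>m = p + i b\<close>, the chord is \<open>m\<close> times the cycle point
  times \<open>2 i sin h\<close> times the unit number of angle \<open>h\<close>. Rotation
  invariance removes \<open>k\<close>: it enters the computation only through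
  \<open>C\<^sup>2 + S\<^sup>2 = 1\<close>.\<close>

lemma xcirc_chord:
  fixes K :: nat and \<mu> L \<gamma> \<beta> :: real and k i :: int
  defines "M \<equiv> M_mat K \<mu> L \<gamma> \<beta>" and "p \<equiv> M_re K \<mu> L \<gamma> \<beta>" and "b \<equiv> M_im K \<mu> L \<gamma> \<beta>"
    and "h \<equiv> of_int i * theta K / 2"
  shows "inner (xcirc K k - M *v xcirc K k) (M *v xcirc K (k + i) - M *v xcirc K k)
           = - 2 * sin h * ((p - p\<^sup>2 - b\<^sup>2) * sin h + b * cos h)" (is ?inner)
    and "norm (M *v xcirc K (k + i) - M *v xcirc K k) = 2 * \<bar>sin h\<bar> * sqrt (p\<^sup>2 + b\<^sup>2)" (is ?norm)
proof -
  define C S c s where "C = cos (of_int k * theta K)" and "S = sin (of_int k * theta K)"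
    and "c = cos h" and "s = sin h"
  have CS: "C\<^sup>2 + S\<^sup>2 = 1" and cs: "c\<^sup>2 + s\<^sup>2 = 1" by (simp_all add: C_def S_def c_def s_def)
  have "of_int (k + i) * theta K = of_int k * theta K + 2 * h"
    by (simp add: h_def distrib_right)
  hence "cos (of_int (k + i) * theta K) = C * cos (2 * h) - S * sin (2 * h)"
    and "sin (of_int (k + i) * theta K) = S * cos (2 * h) + C * sin (2 * h)"
    by (simp_all only: cos_add sin_add C_def S_def)
  moreover have "cos (2 * h) = 1 - 2 * s\<^sup>2" "sin (2 * h) = 2 * s * c"
    using cs by (simp_all add: cos_double sin_double c_def s_def)
  ultimately have ki: "cos (of_int (k + i) * theta K) = C - 2 * s * (C * s + S * c)"
      "sin (of_int (k + i) * theta K) = S + 2 * s * (C * c - S * s)"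
    by (simp_all only:) (simp_all add: algebra_simps power2_eq_square)
  hence D: "vec_nth (M *v xcirc K (k + i) - M *v xcirc K k) 1
        = - 2 * s * (p * (C * s + S * c) + b * (C * c - S * s))"
      "vec_nth (M *v xcirc K (k + i) - M *v xcirc K k) 2
        = 2 * s * (p * (C * c - S * s) - b * (C * s + S * c))"
    unfolding vector_minus_component M_def M_mat_mult_xcirc_nth ki p_def b_def
      C_def[symmetric] S_def[symmetric]
    by (simp_all add: algebra_simps)
  have E: "vec_nth (xcirc K k - M *v xcirc K k) 1 = (1 - p) * C + b * S"
      "vec_nth (xcirc K k - M *v xcirc K k) 2 = (1 - p) * S - b * C"
    by (simp_all add: M_def M_mat_mult_xcirc_nth C_def S_def p_def b_def algebra_simps)
  have "inner (xcirc K k - M *v xcirc K k) (M *v xcirc K (k + i) - M *v xcirc K k)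
      = (C\<^sup>2 + S\<^sup>2) * (- 2 * s * ((p - p\<^sup>2 - b\<^sup>2) * s + b * c))"
    unfolding inner_vec_def sum_2 E D inner_real_def by (simp add: algebra_simps power2_eq_square)
  thus ?inner by (simp add: CS c_def s_def)
  have "(norm (M *v xcirc K (k + i) - M *v xcirc K k))\<^sup>2
      = (C\<^sup>2 + S\<^sup>2) * (c\<^sup>2 + s\<^sup>2) * (4 * s\<^sup>2 * (p\<^sup>2 + b\<^sup>2))"
    unfolding power2_norm_eq_inner inner_vec_def sum_2 D inner_real_def
    by (simp add: algebra_simps power2_eq_square)
  hence "(norm (M *v xcirc K (k + i) - M *v xcirc K k))\<^sup>2 = (2 * \<bar>s\<bar> * sqrt (p\<^sup>2 + b\<^sup>2))\<^sup>2"
    by (simp add: CS cs power_mult_distrib)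
  thus ?norm
    unfolding s_def by (rule power2_eq_imp_eq) simp_all
qed

section \<open>The neighbourhoods of the cycle\<close>

text \<open>The obtuse-angle condition characterizing a projection describes a half-space in
  \<open>z\<close>, so checking it on the generators suffices for the whole hull.\<close>

lemma closest_point_hull_eqI:
  fixes A :: "'a::euclidean_space set"
  assumes "finite A" "y \<in> A" and A: "\<And>z. z \<in> A \<Longrightarrow> inner (x - y) (z - y) \<le> 0"
  shows "closest_point (convex hull A) x = y"
proof -
  have "convex hull A \<subseteq> {z. inner (x - y) z \<le> inner (x - y) y}"
    using A by (intro hull_minimal convex_halfspace_le) (auto simp: inner_diff_right)
  hence *: "inner (x - y) (z - y) \<le> 0" if "z \<in> convex hull A" for z
    using that by (auto simp: inner_diff_right)
  have "dist x y \<le> dist x z" if "z \<in> convex hull A" for z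
  proof -
    have "(norm (x - y))\<^sup>2 \<le> (norm (x - y))\<^sup>2 - 2 * inner (x - y) (z - y) + (norm (z - y))\<^sup>2"
      using *[OF that] zero_le_power2[of "norm (z - y)"] by linarith
    also have "\<dots> = (norm (x - z))\<^sup>2"
      by (simp add: power2_norm_eq_inner algebra_simps inner_simps inner_commute)
    finally show ?thesis by (simp add: dist_norm power2_le_iff_abs_le)
  qed
  moreover have "closed (convex hull A)"
    using assms(1) by (intro compact_imp_closed compact_convex_hull finite_imp_compact)
  ultimately show ?thesis
    using assms(2) by (intro closest_point_unique[symmetric]) (auto intro: hull_inc)
qed

text \<open>Since \<open>b \<le> 0\<close>, the quotient \<open>a + b cot \<phi>\<close> increases with \<open>\<phi>\<close>.\<close>

lemma trig_form_mono:
  fixes a b \<alpha> \<phi> :: real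
  assumes "0 < \<alpha>" "\<alpha> \<le> \<phi>" "\<phi> \<le> pi - \<alpha>" and b: "b \<le> 0"
    and w: "0 \<le> a * sin \<alpha> + b * cos \<alpha>"
  shows "a * sin \<alpha> + b * cos \<alpha> \<le> a * sin \<phi> + b * cos \<phi>"
proof -
  define w where "w = a * sin \<alpha> + b * cos \<alpha>"
  have s\<alpha>: "0 < sin \<alpha>" using assms by (intro sin_gt_zero) auto
  have "sin \<alpha> \<le> sin \<phi>"
  proof (cases "\<phi> \<le> pi / 2")
    case True
    thus ?thesis using assms by (intro sin_monotone_2pi_le) auto
  next
    case False
    hence "sin \<alpha> \<le> sin (pi - \<phi>)" using assms by (intro sin_monotone_2pi_le) auto
    thus ?thesis by simp
  qed
  \<comment> \<open>The cotangent comparison is multiplied out by \<open>sin \<alpha>\<close>; the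
    discrepancy is \<open>- b * sin (\<phi> - \<alpha>)\<close>, nonnegative because
    \<open>b \<le> 0\<close>.\<close>
  hence "sin \<alpha> * w \<le> sin \<phi> * w" using w by (intro mult_right_mono) (auto simp: w_def)
  also have "\<dots> \<le> sin \<phi> * w - b * sin (\<phi> - \<alpha>)"
    using assms sin_ge_zero[of "\<phi> - \<alpha>"] by (simp add: mult_nonpos_nonneg)
  also have "\<dots> = sin \<alpha> * (a * sin \<phi> + b * cos \<phi>)"
    by (simp add: w_def sin_diff algebra_simps)
  finally show ?thesis using s\<alpha> by (simp add: w_def)
qed

text \<open>By Cauchy-Schwarz, \<open>\<delta>\<close> contributes at most
  \<open>norm \<delta> * 2 * sin \<phi> * m\<close> along a chord, while the unperturbed point
  leaves a margin of \<open>2 * sin \<phi> * (a * sin \<phi> + b * cos \<phi>)\<close>. The bracket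
  is smallest at \<open>\<phi> = \<alpha>\<close>, where it equals \<open>m * r_max\<close>.\<close>

lemma closest_point_near_cycle:
  fixes \<delta> :: "real ^ 2"
  assumes \<mu>L: "\<mu> < L" and K: "2 \<le> K" and \<gamma>: "0 < \<gamma>" and \<beta>: "\<beta> \<le> 1"
    and \<delta>: "norm \<delta> \<le> r_max K \<mu> L \<gamma> \<beta>"
  shows "closest_point (M_hull K \<mu> L \<gamma> \<beta>) (xcirc K t + \<delta>) = M_mat K \<mu> L \<gamma> \<beta> *v xcirc K t"
  unfolding M_hull_def
proof (rule closest_point_hull_eqI)
  let ?M = "M_mat K \<mu> L \<gamma> \<beta>"
  have xmod: "xcirc K (t' mod int K) = xcirc K t'" for t'
    using K by (intro xcirc_mod) simp
  show "?M *v xcirc K t \<in> (\<lambda>k. ?M *v xcirc K (int k)) ` {..<K}"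
    using K xmod[of t] by (intro image_eqI[of _ _ "nat (t mod int K)"]) (auto simp: nat_less_iff)
  fix z assume "z \<in> (\<lambda>k. ?M *v xcirc K (int k)) ` {..<K}"
  then obtain j where z: "z = ?M *v xcirc K (int j)" by auto
  \<comment> \<open>Reduction modulo \<open>K\<close> places a nonzero offset between
    \<open>1\<close> and \<open>K - 1\<close>, hence \<open>\<phi>\<close> between
    \<open>\<alpha>\<close> and \<open>pi - \<alpha>\<close>, as \<open>trig_form_mono\<close>
    requires.\<close>
  define i where "i = (int j - t) mod int K"
  have i: "0 \<le> i" "i \<le> int K - 1"
    using K pos_mod_bound[of "int K" "int j - t"] by (simp_all add: i_def)
  have "xcirc K (t + i) = xcirc K (int j)"
    using xmod[of "t + i"] xmod[of "int j"] by (simp add: i_def mod_simps)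
  hence z: "z = ?M *v xcirc K (t + i)" by (simp add: z)
  define p b a m where "p = M_re K \<mu> L \<gamma> \<beta>" and "b = M_im K \<mu> L \<gamma> \<beta>"
    and "a = p - p\<^sup>2 - b\<^sup>2" and "m = sqrt (p\<^sup>2 + b\<^sup>2)"
  define \<alpha> where "\<alpha> = pi / real K"
  define \<phi> where "\<phi> = of_int i * \<alpha>"
  define w where "w = a * sin \<alpha> + b * cos \<alpha>"
  have \<theta>: "theta K / 2 = \<alpha>" by (simp add: theta_def \<alpha>_def)
  have \<alpha>: "0 < \<alpha>" "\<alpha> \<le> pi / 2" using K by (simp_all add: \<alpha>_def field_simps)
  have s\<alpha>: "0 < sin \<alpha>" using \<alpha> by (intro sin_gt_zero) auto
  have "0 \<le> sin (theta K)" unfolding \<theta>[symmetric] using \<alpha> \<theta> by (intro sin_ge_zero) auto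
  hence b: "b \<le> 0"
    using \<mu>L \<gamma> \<beta> by (simp add: b_def M_im_def divide_nonneg_pos)
  have inn: "inner (xcirc K t - ?M *v xcirc K t) (?M *v xcirc K (t + l) - ?M *v xcirc K t)
      = - 2 * sin (of_int l * \<alpha>) * (a * sin (of_int l * \<alpha>) + b * cos (of_int l * \<alpha>))" for t l
    using xcirc_chord(1)[where K = K and k = t and i = l and \<mu> = \<mu> and L = L and \<gamma> = \<gamma> and \<beta> = \<beta>] by (simp add: p_def b_def a_def flip: \<theta>)
  have nrm: "norm (?M *v xcirc K (t + l) - ?M *v xcirc K t) = 2 * \<bar>sin (of_int l * \<alpha>)\<bar> * m" for t l
    using xcirc_chord(2)[where K = K and k = t and i = l and \<mu> = \<mu> and L = L and \<gamma> = \<gamma> and \<beta> = \<beta>] by (simp add: p_def b_def m_def flip: \<theta>)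
  \<comment> \<open>Stated as a product rather than a quotient so that it also holds when
    \<open>M\<close> vanishes; both sides are then zero.\<close>
  have mr: "m * r_max K \<mu> L \<gamma> \<beta> = w"
  proof (cases "m = 0")
    case True
    hence "p = 0" "b = 0" by (simp_all add: m_def sum_power2_eq_zero_iff)
    thus ?thesis using True by (simp add: w_def a_def)
  next
    case False
    have "r_max K \<mu> L \<gamma> \<beta> = (2 * sin \<alpha> * w) / (2 * sin \<alpha> * m)"
      using inn[of 0 1] nrm[of 0 1] s\<alpha>
      by (simp add: r_max_def Let_def matrix_vector_mult_diff_distrib
          matrix_vector_mult_diff_rdistrib w_def)
    thus ?thesis using False s\<alpha> by simp
  qed
  have m0: "0 \<le> m" by (simp add: m_def)
  have r0: "0 \<le> r_max K \<mu> L \<gamma> \<beta>" using \<delta> norm_ge_zero[of \<delta>] by linarith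
  have w0: "0 \<le> w" unfolding mr[symmetric] using m0 r0 by simp
  show "inner (xcirc K t + \<delta> - ?M *v xcirc K t) (z - ?M *v xcirc K t) \<le> 0"
  proof (cases "i = 0")
    case True
    thus ?thesis by (simp add: z)
  next
    case False
    hence "1 \<le> i" using i by simp
    hence \<phi>1: "\<alpha> \<le> \<phi>" using \<alpha> mult_right_mono[of 1 "of_int i" \<alpha>] by (simp add: \<phi>_def)
    have "\<phi> \<le> (real K - 1) * \<alpha>"
      unfolding \<phi>_def using i \<alpha> by (intro mult_right_mono) auto
    also have "\<dots> = pi - \<alpha>" using K by (simp add: \<alpha>_def field_simps)
    finally have \<phi>2: "\<phi> \<le> pi - \<alpha>" .
    have s\<phi>: "0 \<le> sin \<phi>" using \<phi>1 \<phi>2 \<alpha> by (intro sin_ge_zero) auto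
    have "inner \<delta> (z - ?M *v xcirc K t) \<le> norm \<delta> * (2 * sin \<phi> * m)"
      using norm_cauchy_schwarz[of \<delta> "z - ?M *v xcirc K t"] nrm[of t i] s\<phi> by (simp add: z \<phi>_def)
    also have "\<dots> \<le> r_max K \<mu> L \<gamma> \<beta> * (2 * sin \<phi> * m)"
      using \<delta> s\<phi> m0 by (intro mult_right_mono) auto
    also have "\<dots> = 2 * sin \<phi> * w" by (simp flip: mr)
    also have "\<dots> \<le> 2 * sin \<phi> * (a * sin \<phi> + b * cos \<phi>)"
      using trig_form_mono[OF \<alpha>(1) \<phi>1 \<phi>2 b] w0 s\<phi> by (intro mult_left_mono) (auto simp: w_def)
    also have "\<dots> = - inner (xcirc K t - ?M *v xcirc K t) (z - ?M *v xcirc K t)"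
      using inn[of t i] by (simp add: z \<phi>_def)
    finally show ?thesis by (simp add: inner_simps algebra_simps)
  qed
qed simp

lemma V_nbhd_mod:
  assumes "0 < K"
  shows "V_nbhd K \<mu> L \<gamma> \<beta> (t mod K) = V_nbhd K \<mu> L \<gamma> \<beta> t"
  using xcirc_mod[OF assms, of "int t"] by (simp add: V_nbhd_def zmod_int)

section \<open>Heavy-ball dynamics near the cycle\<close>

lemma HB_quadratic_rec:
  "HB \<gamma> \<beta> (\<lambda>x. \<mu> / 2 * (norm x)\<^sup>2) \<delta>0 \<delta>1 (Suc (Suc t)) =
     (1 + \<beta> - \<gamma> * \<mu>) *\<^sub>R HB \<gamma> \<beta> (\<lambda>x. \<mu> / 2 * (norm x)\<^sup>2) \<delta>0 \<delta>1 (Suc t)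
       - \<beta> *\<^sub>R HB \<gamma> \<beta> (\<lambda>x. \<mu> / 2 * (norm x)\<^sup>2) \<delta>0 \<delta>1 t"
  unfolding HB.simps(3) grad_eqI[OF GDERIV_norm_squared] by (simp add: algebra_simps)

text \<open>Smallness is assumed of \<open>d\<close>, which obeys its own linear recurrence, so no
  circular argument about staying in the balls arises. In each step the \<open>M\<close> term of the
  gradient moves the cycle one point forward, and the rest is the quadratic recurrence for
  \<open>d\<close>.\<close>

lemma HB_psi_eq_cycle_plus_HB_quadratic:
  fixes \<delta>0 \<delta>1 :: "real ^ 2" and \<mu> L \<gamma> \<beta> :: real and K :: nat
  defines "d \<equiv> HB \<gamma> \<beta> (\<lambda>x. \<mu> / 2 * (norm x)\<^sup>2) \<delta>0 \<delta>1"
  assumes \<mu>L: "\<mu> < L" and K: "2 \<le> K" and \<gamma>: "0 < \<gamma>" and \<beta>: "\<beta> \<le> 1"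
    and small: "\<And>t. norm (d t) \<le> r_max K \<mu> L \<gamma> \<beta>"
  shows "HB \<gamma> \<beta> (psi K \<mu> L \<gamma> \<beta>) (xcirc K 0 + \<delta>0) (xcirc K 1 + \<delta>1) t = xcirc K (int t) + d t"
    (is "?z t = _")
proof (induction t rule: induct_nat_012)
  case (ge2 t)
  let ?x = "\<lambda>i. xcirc K (int t + i)"
  let ?N = "(L - \<mu>) * \<gamma>"
  have "?N \<noteq> 0" using \<mu>L \<gamma> by simp
  hence M: "?N *\<^sub>R (M_mat K \<mu> L \<gamma> \<beta> *v ?x 1)
      = (1 + \<beta> - \<mu> * \<gamma>) *\<^sub>R ?x 1 - ?x 2 - \<beta> *\<^sub>R ?x 0"
    unfolding M_mat_mult_xcirc by (simp add: add.commute)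
  have z: "?z (Suc t) = ?x 1 + d (Suc t)" "?z t = ?x 0 + d t"
    using ge2 by (simp_all add: add.commute)
  have G: "\<gamma> *\<^sub>R grad (psi K \<mu> L \<gamma> \<beta>) (?x 1 + d (Suc t))
      = (\<gamma> * \<mu>) *\<^sub>R (?x 1 + d (Suc t)) + ?N *\<^sub>R (M_mat K \<mu> L \<gamma> \<beta> *v ?x 1)"
    using closest_point_near_cycle[OF \<mu>L K \<gamma> \<beta> small[of "Suc t"], of "int t + 1"]
    by (simp add: grad_psi[OF K] scaleR_add_right mult.commute)
  have "?z (Suc (Suc t)) = ?x 2 + ((1 + \<beta> - \<gamma> * \<mu>) *\<^sub>R d (Suc t) - \<beta> *\<^sub>R d t)"
    unfolding HB.simps(3) z G M by (simp add: algebra_simps)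
  thus ?case by (simp only: d_def HB_quadratic_rec) (simp add: add.commute)
qed (simp_all add: d_def)

section \<open>Local convergence to the cycle\<close>

theorem theorem4p2:
  fixes \<mu> L \<gamma> \<beta> :: real and K :: nat
  assumes "0 < \<mu>" and "\<mu> < L" and "2 \<le> K"
    and "(\<gamma>, \<beta>) \<in> Omega_circ K \<mu> L"
  shows "\<exists>\<kappa>>0. \<forall>\<delta>0 \<delta>1 :: real ^ 2.
    sqrt ((norm \<delta>0)\<^sup>2 + (norm \<delta>1)\<^sup>2) \<le> \<kappa> * r_max K \<mu> L \<gamma> \<beta> \<longrightarrow>
    (let z = HB \<gamma> \<beta> (psi K \<mu> L \<gamma> \<beta>) (xcirc K 0 + \<delta>0) (xcirc K 1 + \<delta>1);
         \<delta> = (\<lambda>t. z t - xcirc K (int t))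
     in (\<forall>t. z t \<in> V_nbhd K \<mu> L \<gamma> \<beta> (t mod K)) \<and>
        (\<forall>t. \<delta> t = HB \<gamma> \<beta> (\<lambda>x. \<mu> / 2 * (norm x)\<^sup>2) \<delta>0 \<delta>1 t) \<and>
        (\<forall>t\<ge>1. \<delta> (t + 1) = \<delta> t - (\<gamma> * \<mu>) *\<^sub>R \<delta> t + \<beta> *\<^sub>R (\<delta> t - \<delta> (t - 1))) \<and>
        (\<lambda>t. norm (\<delta> t)) \<longlonglongrightarrow> 0 \<and>
        converges_at_rate \<delta> (rho_quad \<gamma> \<beta> \<mu>))"
proof -
  let ?\<rho> = "rho_quad \<gamma> \<beta> \<mu>" and ?r = "r_max K \<mu> L \<gamma> \<beta>"
  from assms have \<beta>: "- 1 < \<beta>" "\<beta> < 1" and \<gamma>: "0 < \<gamma>" "\<gamma> < 2 / L * (1 + \<beta>)"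
    by (auto simp: Omega_circ_def Omega_cv_Q_def)
  \<comment> \<open>The step-size condition for \<open>L\<close> yields
    \<open>0 < \<gamma> * \<mu> < 2 * (1 + \<beta>)\<close>, which is the stability condition for
    curvature \<open>\<mu>\<close>.\<close>
  have "\<gamma> * \<mu> < \<gamma> * L" using \<gamma> assms by simp
  also have "\<dots> < 2 * (1 + \<beta>)" using \<gamma> assms by (simp add: field_simps)
  finally have "\<bar>1 + \<beta> - \<gamma> * \<mu>\<bar> < 1 + \<beta>" using \<gamma> assms(1) by (simp add: abs_if)
  hence \<rho>1: "?\<rho> < 1" using \<beta> by (intro rho_quad_less_1) auto
  obtain l1 l2 :: complex where l: "l1 + l2 = complex_of_real (1 + \<beta> - \<gamma> * \<mu>)" "l1 * l2 = complex_of_real \<beta>"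
    by (rule complex_quadratic_factors)
  have "norm l1 \<le> ?\<rho>"
    by (rule root_le_rho_quad) (simp only: l[symmetric], simp add: algebra_simps power2_eq_square)
  hence \<rho>0: "0 \<le> ?\<rho>" using norm_ge_zero[of l1] by linarith
  define C where "C = (\<lambda>r. real CARD(2) * (1 + (1 + ?\<rho>) / (r - ?\<rho>)))"
  have C: "0 < C r" if "?\<rho> < r" for r
    unfolding C_def using \<rho>0 that by (intro mult_pos_pos add_pos_nonneg divide_nonneg_nonneg) auto
  \<comment> \<open>Any rate strictly between \<open>?\<rho>\<close> and \<open>1\<close> keeps all
    errors below \<open>C q * D\<close>; with \<open>\<kappa> = 1 / C q\<close> this stays within
    \<open>r_max\<close>.\<close>
  define q where "q = (?\<rho> + 1) / 2"
  have q: "?\<rho> < q" "q < 1" "0 < q" using \<rho>0 \<rho>1 by (simp_all add: q_def)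
  show ?thesis
  proof (intro exI[of _ "1 / C q"] conjI allI impI)
    show "0 < 1 / C q" using C[OF q(1)] by simp
  next
    fix \<delta>0 \<delta>1 :: "real ^ 2"
    define D where "D = sqrt ((norm \<delta>0)\<^sup>2 + (norm \<delta>1)\<^sup>2)"
    assume "sqrt ((norm \<delta>0)\<^sup>2 + (norm \<delta>1)\<^sup>2) \<le> 1 / C q * ?r"
    hence D: "C q * D \<le> ?r" using C[OF q(1)] by (simp add: D_def field_simps)
    have D0: "0 \<le> D" by (simp add: D_def)
    define d where "d = HB \<gamma> \<beta> (\<lambda>x. \<mu> / 2 * (norm x)\<^sup>2) \<delta>0 \<delta>1"
    have rec: "d (Suc (Suc t)) = (1 + \<beta> - \<gamma> * \<mu>) *\<^sub>R d (Suc t) - \<beta> *\<^sub>R d t" for t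
      unfolding d_def by (rule HB_quadratic_rec)
    have bound: "norm (d t) \<le> C r * r ^ t * D" if "?\<rho> < r" for t r
      using vector_recurrence_bound[of d "1 + \<beta> - \<gamma> * \<mu>" \<beta> ?\<rho> r t, OF rec root_le_rho_quad that]
      by (simp add: C_def D_def d_def)
    have small: "norm (d t) \<le> ?r" for t
    proof -
      have "norm (d t) \<le> (C q * D) * q ^ t" using bound[OF q(1), of t] by (simp add: mult_ac)
      also have "\<dots> \<le> C q * D"
        using q C[OF q(1)] D0 by (intro mult_left_le) (auto intro: power_le_one)
      finally show ?thesis using D by linarith
    qed
    define z where "z = HB \<gamma> \<beta> (psi K \<mu> L \<gamma> \<beta>) (xcirc K 0 + \<delta>0) (xcirc K 1 + \<delta>1)"
    have z: "z t = xcirc K (int t) + d t" for t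
      unfolding z_def d_def using assms \<gamma> \<beta> small
      by (intro HB_psi_eq_cycle_plus_HB_quadratic) (auto simp: d_def)
    hence \<delta>: "z t - xcirc K (int t) = d t" for t by simp
    have V: "z t \<in> V_nbhd K \<mu> L \<gamma> \<beta> (t mod K)" for t
    proof -
      have cp: "closest_point (M_hull K \<mu> L \<gamma> \<beta>) (xcirc K (int t) + \<epsilon>) = M_mat K \<mu> L \<gamma> \<beta> *v xcirc K (int t)"
        if "norm \<epsilon> \<le> ?r" for \<epsilon>
        using assms \<gamma> \<beta> that by (intro closest_point_near_cycle) auto
      \<comment> \<open>Nonnegativity of \<open>r_max\<close> admits the zero perturbation, which
        identifies the projection of the cycle point itself, as membership in \<open>V_nbhd\<close>
        demands.\<close>
      have "norm (0 :: real ^ 2) \<le> ?r"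
        using order_trans[OF norm_ge_zero small] by (simp only: norm_zero)
      from cp[OF this] cp[OF small[of t]]
      have "closest_point (M_hull K \<mu> L \<gamma> \<beta>) (z t) = closest_point (M_hull K \<mu> L \<gamma> \<beta>) (xcirc K (int t))"
        by (simp only: z add_0_right)
      hence "z t \<in> V_nbhd K \<mu> L \<gamma> \<beta> t" by (simp only: V_nbhd_def mem_Collect_eq)
      thus ?thesis using assms(3) by (subst V_nbhd_mod) simp_all
    qed
    have rec': "d (t + 1) = d t - (\<gamma> * \<mu>) *\<^sub>R d t + \<beta> *\<^sub>R (d t - d (t - 1))" if "1 \<le> t" for t
      using that by (cases t) (simp_all add: rec algebra_simps)
    have lim: "(\<lambda>t. norm (d t)) \<longlonglongrightarrow> 0"
    proof (rule tendsto_sandwich[OF _ _ tendsto_const])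
      have "(\<lambda>t. C q * q ^ t * D) \<longlonglongrightarrow> C q * 0 * D"
        using q by (intro tendsto_intros LIMSEQ_power_zero) auto
      thus "(\<lambda>t. C q * q ^ t * D) \<longlonglongrightarrow> 0" by simp
    qed (simp_all add: bound[OF q(1)])
    have rate: "converges_at_rate d ?\<rho>"
      unfolding converges_at_rate_def
    proof (intro allI impI)
      fix \<epsilon> :: real assume \<epsilon>: "0 < \<epsilon>"
      \<comment> \<open>Only half of \<open>\<epsilon>\<close> goes into the rate; the other half
        makes \<open>(r / (?\<rho> + \<epsilon>)) ^ t\<close> tend to zero and so eventually absorbs
        the constant \<open>C r\<close>.\<close>
      define r where "r = ?\<rho> + \<epsilon> / 2"
      have r: "?\<rho> < r" "0 < r" "r < ?\<rho> + \<epsilon>" using \<epsilon> \<rho>0 by (simp_all add: r_def)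
      have "(\<lambda>t. C r * (r / (?\<rho> + \<epsilon>)) ^ t) \<longlonglongrightarrow> C r * 0"
        using r by (intro tendsto_intros LIMSEQ_power_zero) auto
      hence "eventually (\<lambda>t. C r * (r / (?\<rho> + \<epsilon>)) ^ t < 1) sequentially"
        by (rule order_tendstoD(2)) simp
      then obtain T0 where T0: "C r * (r / (?\<rho> + \<epsilon>)) ^ t < 1" if "T0 \<le> t" for t
        unfolding eventually_sequentially by blast
      have "norm (d t) \<le> (?\<rho> + \<epsilon>) ^ t * D" if "T0 \<le> t" for t
      proof -
        have "C r * r ^ t \<le> (?\<rho> + \<epsilon>) ^ t"
          using T0[OF that] r by (simp add: power_divide field_simps)
        with bound[OF r(1), of t] D0 show ?thesis
          by (meson mult_right_mono order_trans)
      qed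
      thus "\<exists>T0. \<forall>t\<ge>T0. norm (d t) \<le> (?\<rho> + \<epsilon>) ^ t * sqrt ((norm (d 0))\<^sup>2 + (norm (d 1))\<^sup>2)"
        by (intro exI[of _ T0]) (simp add: D_def d_def)
    qed
    show "let z = HB \<gamma> \<beta> (psi K \<mu> L \<gamma> \<beta>) (xcirc K 0 + \<delta>0) (xcirc K 1 + \<delta>1);
         \<delta> = (\<lambda>t. z t - xcirc K (int t))
     in (\<forall>t. z t \<in> V_nbhd K \<mu> L \<gamma> \<beta> (t mod K)) \<and>
        (\<forall>t. \<delta> t = HB \<gamma> \<beta> (\<lambda>x. \<mu> / 2 * (norm x)\<^sup>2) \<delta>0 \<delta>1 t) \<and>
        (\<forall>t\<ge>1. \<delta> (t + 1) = \<delta> t - (\<gamma> * \<mu>) *\<^sub>R \<delta> t + \<beta> *\<^sub>R (\<delta> t - \<delta> (t - 1))) \<and>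
        (\<lambda>t. norm (\<delta> t)) \<longlonglongrightarrow> 0 \<and> converges_at_rate \<delta> ?\<rho>"
      unfolding Let_def z_def[symmetric] \<delta> d_def[symmetric]
      using V rec' lim rate by blast
  qed
qed

end
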